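(* Let $X$ be a real Banach space with a normalized subsymmetric basis $(\varphi_i)_{i\ge1}$ whose subsymmetric constant is $1$. Then for every $n\in\mathbb{N}_{\mathcal H}$ $$\varrho_n\le\lambda([\sqrt n]+1)\,n,$$ where $[\sqrt n]$ is the integer part of $\sqrt n$.
   Context: A (Schauder) basis $(\varphi_i)$ of a Banach space $X$ is normalized if $\|\varphi_i\|=1$ for all $i$. It is unconditional if $(\varphi_{\pi(i)})$ is a basis of $X$ for every permutation $\pi$ of $\mathbb{N}$. Two bases $(\varphi_i)$, $(\psi_i)$ are equivalent if $\sum\alpha_i\varphi_i$ converges if and only if $\sum\alpha_i\psi_i$ converges. A basis is subsymmetric if it is unconditional and $(\varphi_{i_n})$ is equivalent to $(\varphi_i)$ for every increasing sequence of positive integers $(i_n)$. Its subsymmetric constant is the smallest $K$ such that $\|\sum_{n}\vartheta_n\alpha_n\varphi_{i_n}\|\le K\|\sum_{i}\alpha_i\varphi_i\|$ for all scalars $(\alpha_i)$ for which $\sum_i\alpha_i\varphi_i$ converges, all signs $\vartheta_n\in\{-1,1\}$ and all increasing sequences of positive integers $(i_n)$. $\lambda(n)=\left\|\sum_{i=1}^n\varphi_i\right\|$. A Hadamard matrix of order $n$ is an $n\times n$ matrix with entries $\pm1$ whose columns (equivalently, rows) are pairwise orthogonal. $\mathbb{N}_{\mathcal H}$ is the set of positive integers $n$ for which a Hadamard matrix of order $n$ exists, and $\mathcal H_n^{all}$ is the set of all Hadamard matrices of order $n$. For $\mathcal H_n=[h^n_{ki}]\in\mathcal H_n^{all}$ ($k$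 the row index, $i$ the column index) put $$\varrho_{\mathcal H_n}=\max_{1\le m\le n}\left\|\sum_{i=1}^n\left(\sum_{k=1}^m h^n_{ki}\right)\varphi_i\right\|,\qquad \varrho_n=\max_{\mathcal H_n\in\mathcal H_n^{all}}\varrho_{\mathcal H_n}.$$ *)

theory Defs
  imports Complex_Main "Jordan_Normal_Form.Matrix"
begin

text \<open>
  Sequences and matrix indices start at 0: the vector \<open>\<phi> i\<close> stands for the basis vector
  with number \<open>i + 1\<close>. A Banach space is a type of class \<^class>\<open>banach\<close>; it is a real space.
\<close>

definition schauder_basis :: "(nat \<Rightarrow> 'a::banach) \<Rightarrow> bool" where
  "schauder_basis \<phi> \<longleftrightarrow> (\<forall>x. \<exists>!\<alpha>::nat \<Rightarrow> real. (\<lambda>i. \<alpha> i *\<^sub>R \<phi> i) sums x)"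

definition normalized :: "(nat \<Rightarrow> 'a::banach) \<Rightarrow> bool" where
  "normalized \<phi> \<longleftrightarrow> (\<forall>i. norm (\<phi> i) = 1)"

definition unconditional_basis :: "(nat \<Rightarrow> 'a::banach) \<Rightarrow> bool" where
  "unconditional_basis \<phi> \<longleftrightarrow>
     schauder_basis \<phi> \<and> (\<forall>\<pi>::nat \<Rightarrow> nat. bij \<pi> \<longrightarrow> schauder_basis (\<lambda>i. \<phi> (\<pi> i)))"

text \<open>
  Equivalence is defined for arbitrary sequences, since a subsequence of a basis is a basis only
  of its closed linear span.
\<close>

definition equivalent_seqs :: "(nat \<Rightarrow> 'a::banach) \<Rightarrow> (nat \<Rightarrow> 'b::banach) \<Rightarrow> bool" where
  "equivalent_seqs \<phi> \<psi> \<longleftrightarrow>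
     (\<forall>\<alpha>::nat \<Rightarrow> real. summable (\<lambda>i. \<alpha> i *\<^sub>R \<phi> i) \<longleftrightarrow> summable (\<lambda>i. \<alpha> i *\<^sub>R \<psi> i))"

definition subsymmetric_basis :: "(nat \<Rightarrow> 'a::banach) \<Rightarrow> bool" where
  "subsymmetric_basis \<phi> \<longleftrightarrow>
     unconditional_basis \<phi> \<and>
     (\<forall>\<iota>::nat \<Rightarrow> nat. strict_mono \<iota> \<longrightarrow> equivalent_seqs (\<lambda>n. \<phi> (\<iota> n)) \<phi>)"

text \<open>
  The summability conjunct makes explicit that the series whose norm is bounded converges, because
  \<^const>\<open>suminf\<close> is unspecified otherwise. It holds automatically for a subsymmetric basis.
\<close>

definition subsymmetric_bound :: "(nat \<Rightarrow> 'a::banach) \<Rightarrow> real \<Rightarrow> bool" where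
  "subsymmetric_bound \<phi> K \<longleftrightarrow>
     (\<forall>(\<alpha>::nat \<Rightarrow> real) (\<theta>::nat \<Rightarrow> real) (\<iota>::nat \<Rightarrow> nat).
        summable (\<lambda>i. \<alpha> i *\<^sub>R \<phi> i) \<and> (\<forall>n. \<theta> n \<in> {-1, 1}) \<and> strict_mono \<iota> \<longrightarrow>
          summable (\<lambda>n. (\<theta> n * \<alpha> n) *\<^sub>R \<phi> (\<iota> n)) \<and>
          norm (\<Sum>n. (\<theta> n * \<alpha> n) *\<^sub>R \<phi> (\<iota> n)) \<le> K * norm (\<Sum>i. \<alpha> i *\<^sub>R \<phi> i))"

text \<open>
  A predicate rather than a function, so that the smallest \<open>K\<close> is never an unspecified value.
\<close>

definition is_subsymmetric_constant :: "(nat \<Rightarrow> 'a::banach) \<Rightarrow> real \<Rightarrow> bool" where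
  "is_subsymmetric_constant \<phi> K \<longleftrightarrow>
     subsymmetric_bound \<phi> K \<and> (\<forall>K'. subsymmetric_bound \<phi> K' \<longrightarrow> K \<le> K')"

definition fundamental_fun :: "(nat \<Rightarrow> 'a::banach) \<Rightarrow> nat \<Rightarrow> real" where
  "fundamental_fun \<phi> n = norm (\<Sum>i<n. \<phi> i)"

definition hadamard_matrices :: "nat \<Rightarrow> real mat set" where
  "hadamard_matrices n =
     {H \<in> carrier_mat n n.
        (\<forall>k<n. \<forall>i<n. H $$ (k, i) \<in> {-1, 1}) \<and>
        (\<forall>i<n. \<forall>j<n. i \<noteq> j \<longrightarrow> col H i \<bullet> col H j = 0)}"

definition hadamard_orders :: "nat set" where
  "hadamard_orders = {n. 0 < n \<and> hadamard_matrices n \<noteq> {}}"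

definition rho_mat :: "(nat \<Rightarrow> 'a::banach) \<Rightarrow> nat \<Rightarrow> real mat \<Rightarrow> real" where
  "rho_mat \<phi> n H = Max ((\<lambda>m. norm (\<Sum>i<n. (\<Sum>k<m. H $$ (k, i)) *\<^sub>R \<phi> i)) ` {1..n})"

definition rho :: "(nat \<Rightarrow> 'a::banach) \<Rightarrow> nat \<Rightarrow> real" where
  "rho \<phi> n = Max (rho_mat \<phi> n ` hadamard_matrices n)"

text \<open>The maximum defining \<^const>\<open>rho\<close> ranges over a finite set.\<close>

lemma finite_hadamard_matrices: "finite (hadamard_matrices n)"
proof -
  let ?F = "PiE ({..<n} \<times> {..<n}) (\<lambda>_. {-1, 1::real})"
  have "H \<in> mat n n ` ?F" if "H \<in> hadamard_matrices n" for H
  proof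
    show "H = mat n n (restrict (\<lambda>p. H $$ p) ({..<n} \<times> {..<n}))"
      using that by (intro eq_matI) (auto simp: hadamard_matrices_def)
    show "restrict (\<lambda>p. H $$ p) ({..<n} \<times> {..<n}) \<in> ?F"
      using that by (auto simp: hadamard_matrices_def)
  qed
  moreover have "finite (mat n n ` ?F)"
    by (intro finite_imageI finite_PiE) auto
  ultimately show ?thesis
    by (meson finite_subset subsetI)
qed

end

theory Submission
  imports Defs "Jordan_Normal_Form.Determinant"
begin

text \<open>
  Fix a Hadamard matrix of order \<open>n\<close> and let \<open>v\<close> be the sum of its first \<open>m\<close> rows. The rows are
  orthogonal of squared length \<open>n\<close>, so \<open>v\<close> has squared Euclidean length \<open>m n \<le> n\<^sup>2\<close>, and
  summing \<open>2 \<surd>n \<bar>v\<^sub>i\<bar> \<le> v\<^sub>i\<^sup>2 + n\<close> over \<open>i\<close> gives \<open>\<Sum>\<bar>v\<^sub>i\<bar> \<le> n \<surd>n \<le> n s\<close> with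
  \<open>s = \<lfloor>\<surd>n\<rfloor> + 1\<close>. Moreover the \<open>v\<^sub>i\<close> are integers with \<open>\<bar>v\<^sub>i\<bar> \<le> m \<le> n\<close>.

  These two bounds, on the largest entry and on the sum of the entries, are exactly what is needed to
  write \<open>\<bar>v\<bar>\<close> as a sum of \<open>n\<close> indicator vectors of sets with at most \<open>s\<close> elements
  (\<open>round_robin_decomposition\<close>): list every index \<open>i\<close> with multiplicity \<open>\<bar>v\<^sub>i\<bar>\<close> and deal the list out
  cyclically to \<open>n\<close> sets. When the subsymmetric constant is \<open>1\<close>, signs do not matter, and an indicator
  vector of a set with at most \<open>s\<close> elements has norm at most \<open>\<lambda>(s)\<close>
  (\<open>norm_sum_le_fundamental_fun\<close>). The triangle inequality over the \<open>n\<close> sets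
  gives the bound \<open>n \<lambda>(s)\<close> for every \<open>m\<close> and every Hadamard matrix.
\<close>

section \<open>Finite sums along a basis with subsymmetric constant 1\<close>

lemma norm_sum_spread_signs_le:
  fixes \<phi> :: "nat \<Rightarrow> 'a::banach" and \<alpha> \<theta> :: "nat \<Rightarrow> real"
  assumes bound: "subsymmetric_bound \<phi> K"
    and \<theta>: "\<And>i. \<theta> i \<in> {-1, 1}"
    and \<iota>: "strict_mono \<iota>"
  shows "norm (\<Sum>i<n. (\<theta> i * \<alpha> i) *\<^sub>R \<phi> (\<iota> i)) \<le> K * norm (\<Sum>i<n. \<alpha> i *\<^sub>R \<phi> i)"
proof -
  define \<beta> where "\<beta> i = (if i < n then \<alpha> i else 0)" for i
  have s1: "(\<lambda>i. \<beta> i *\<^sub>R \<phi> i) sums (\<Sum>i<n. \<beta> i *\<^sub>R \<phi> i)"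
    by (rule sums_finite) (auto simp: \<beta>_def)
  have s2: "(\<lambda>i. (\<theta> i * \<beta> i) *\<^sub>R \<phi> (\<iota> i)) sums (\<Sum>i<n. (\<theta> i * \<beta> i) *\<^sub>R \<phi> (\<iota> i))"
    by (rule sums_finite) (auto simp: \<beta>_def)
  have "norm (\<Sum>i. (\<theta> i * \<beta> i) *\<^sub>R \<phi> (\<iota> i)) \<le> K * norm (\<Sum>i. \<beta> i *\<^sub>R \<phi> i)"
    using bound \<theta> \<iota> sums_summable[OF s1] unfolding subsymmetric_bound_def by blast
  moreover have "(\<Sum>i<n. \<beta> i *\<^sub>R \<phi> i) = (\<Sum>i<n. \<alpha> i *\<^sub>R \<phi> i)"
    by (rule sum.cong) (auto simp: \<beta>_def)
  moreover have "(\<Sum>i<n. (\<theta> i * \<beta> i) *\<^sub>R \<phi> (\<iota> i)) = (\<Sum>i<n. (\<theta> i * \<alpha> i) *\<^sub>R \<phi> (\<iota> i))"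
    by (rule sum.cong) (auto simp: \<beta>_def)
  ultimately show ?thesis
    using sums_unique[OF s1] sums_unique[OF s2] by metis
qed

text \<open>
  The first \<open>k\<close> vectors are the average of \<open>\<phi>\<^sub>0 + \<dots> + \<phi>\<^bsub>s-1\<^esub>\<close> and of the same sum with the signs of
  the terms from \<open>k\<close> on reversed, and reversing signs does not raise the norm.
\<close>

lemma fundamental_fun_mono:
  fixes \<phi> :: "nat \<Rightarrow> 'a::banach"
  assumes bound: "subsymmetric_bound \<phi> 1" and "k \<le> s"
  shows "fundamental_fun \<phi> k \<le> fundamental_fun \<phi> s"
proof -
  define \<theta> :: "nat \<Rightarrow> real" where "\<theta> i = (if i < k then 1 else -1)" for i
  have "norm (\<Sum>i<s. (\<theta> i * 1) *\<^sub>R \<phi> (id i)) \<le> 1 * norm (\<Sum>i<s. 1 *\<^sub>R \<phi> i)"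
    by (rule norm_sum_spread_signs_le[OF bound]) (auto simp: \<theta>_def strict_mono_def)
  hence flip: "norm (\<Sum>i<s. \<theta> i *\<^sub>R \<phi> i) \<le> fundamental_fun \<phi> s"
    by (simp add: fundamental_fun_def)
  have "(\<Sum>i<s. \<phi> i) + (\<Sum>i<s. \<theta> i *\<^sub>R \<phi> i) = (\<Sum>i<s. if i < k then 2 *\<^sub>R \<phi> i else 0)"
    unfolding sum.distrib[symmetric] by (rule sum.cong) (auto simp: \<theta>_def scaleR_2)
  also have "\<dots> = (\<Sum>i<k. 2 *\<^sub>R \<phi> i)"
    using \<open>k \<le> s\<close> by (intro sum.mono_neutral_cong_right) auto
  also have "\<dots> = 2 *\<^sub>R (\<Sum>i<k. \<phi> i)"
    by (simp add: scaleR_sum_right)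
  finally have "2 * fundamental_fun \<phi> k = norm ((\<Sum>i<s. \<phi> i) + (\<Sum>i<s. \<theta> i *\<^sub>R \<phi> i))"
    by (simp add: fundamental_fun_def)
  also have "\<dots> \<le> fundamental_fun \<phi> s + fundamental_fun \<phi> s"
    using flip by (intro norm_triangle_mono) (simp_all add: fundamental_fun_def)
  finally show ?thesis by simp
qed

lemma ex_strict_mono_enumeration:
  fixes A :: "nat set"
  assumes "finite A"
  shows "\<exists>\<iota>. strict_mono \<iota> \<and> bij_betw \<iota> {..<card A} A"
proof -
  define xs where "xs = sorted_list_of_set A"
  have xs: "set xs = A" "distinct xs" "length xs = card A" "sorted_wrt (<) xs"
    using assms by (auto simp: xs_def)
  define \<iota> where "\<iota> i = (if i < card A then xs ! i else Suc (\<Sum>A) + i)" for i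
  have "strict_mono \<iota>"
  proof (rule strict_monoI)
    fix i j :: nat
    assume "i < j"
    consider "j < card A" | "i < card A" "card A \<le> j" | "card A \<le> i"
      by linarith
    thus "\<iota> i < \<iota> j"
    proof cases
      case 1
      thus ?thesis
        using \<open>i < j\<close> sorted_wrt_nth_less[OF xs(4), of i j] xs(3) by (simp add: \<iota>_def)
    next
      case 2
      hence "xs ! i \<in> A"
        using xs(1,3) nth_mem[of i xs] by simp
      hence "xs ! i \<le> \<Sum>A"
        using assms member_le_sum[of "xs ! i" A "\<lambda>x. x"] by simp
      thus ?thesis
        using 2 by (simp add: \<iota>_def)
    next
      case 3
      thus ?thesis
        using \<open>i < j\<close> by (simp add: \<iota>_def)
    qed
  qed
  moreover have "bij_betw \<iota> {..<card A} A \<longleftrightarrow> bij_betw ((!) xs) {..<card A} A"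
    by (rule bij_betw_cong) (simp add: \<iota>_def)
  moreover have "bij_betw ((!) xs) {..<card A} A"
    by (rule bij_betw_nth) (simp_all add: xs)
  ultimately show ?thesis by blast
qed

text \<open>
  Enumerating \<open>A\<close> in increasing order spreads the first \<open>card A\<close> basis vectors over \<open>A\<close>, and
  spreading does not raise the norm.
\<close>

lemma norm_sum_le_fundamental_fun:
  fixes \<phi> :: "nat \<Rightarrow> 'a::banach"
  assumes bound: "subsymmetric_bound \<phi> 1" and "finite A" "card A \<le> s"
  shows "norm (\<Sum>i\<in>A. \<phi> i) \<le> fundamental_fun \<phi> s"
proof -
  obtain \<iota> where \<iota>: "strict_mono \<iota>" "bij_betw \<iota> {..<card A} A"
    using ex_strict_mono_enumeration[OF \<open>finite A\<close>] by blast
  have "norm (\<Sum>i<card A. (1 * 1) *\<^sub>R \<phi> (\<iota> i)) \<le> 1 * norm (\<Sum>i<card A. 1 *\<^sub>R \<phi> i)"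
    by (rule norm_sum_spread_signs_le[OF bound _ \<iota>(1)]) simp
  hence "norm (\<Sum>i\<in>A. \<phi> i) \<le> fundamental_fun \<phi> (card A)"
    using sum.reindex_bij_betw[OF \<iota>(2), of \<phi>] by (simp add: fundamental_fun_def)
  also have "\<dots> \<le> fundamental_fun \<phi> s"
    by (rule fundamental_fun_mono[OF bound \<open>card A \<le> s\<close>])
  finally show ?thesis .
qed

section \<open>Integer vectors as sums of indicator vectors\<close>

text \<open>
  Lay the indices out on a line, index \<open>i\<close> occupying the \<open>w i\<close> consecutive places from \<open>C i\<close> on, and
  give place \<open>t\<close> to the set with number \<open>t mod n\<close>. At most \<open>n\<close> consecutive places fall into
  distinct residue classes, so no set receives an index twice; and each class has at most \<open>s\<close> members
  among the first \<open>n s\<close> places.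
\<close>

lemma round_robin_decomposition:
  fixes w :: "nat \<Rightarrow> nat"
  assumes n: "0 < n" and le: "\<And>i. i < N \<Longrightarrow> w i \<le> n" and total: "(\<Sum>i<N. w i) \<le> n * s"
  obtains A :: "nat \<Rightarrow> nat set"
  where "\<And>c. A c \<subseteq> {..<N}" "\<And>c. card (A c) \<le> s"
    "\<And>i. i < N \<Longrightarrow> card {c. c < n \<and> i \<in> A c} = w i"
proof -
  define C where "C i = (\<Sum>j<i. w j)" for i
  have C_Suc: "C (Suc i) = C i + w i" for i
    by (simp add: C_def)
  have C_mono: "C i \<le> C j" if "i \<le> j" for i j
    unfolding C_def using that by (intro sum_mono2) auto
  define A where "A c = {i. i < N \<and> (\<exists>t\<in>{C i..<C (Suc i)}. t mod n = c)}" for c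
  show thesis
  proof (rule that)
    show "A c \<subseteq> {..<N}" for c
      by (auto simp: A_def)
  next
    fix c
    have "\<forall>i\<in>A c. \<exists>t. t \<in> {C i..<C (Suc i)} \<and> t mod n = c"
      by (auto simp: A_def)
    then obtain t where t: "\<And>i. i \<in> A c \<Longrightarrow> t i \<in> {C i..<C (Suc i)} \<and> t i mod n = c"
      by metis
    have less: "t i < t j" if "i \<in> A c" "j \<in> A c" "i < j" for i j
      using t[OF that(1)] t[OF that(2)] C_mono[of "Suc i" j] that(3) by auto
    have "inj_on (\<lambda>i. t i div n) (A c)"
    proof (rule inj_onI)
      fix i j
      assume ij: "i \<in> A c" "j \<in> A c" and "t i div n = t j div n"
      hence "t i = t j"
        using t by (metis div_mult_mod_eq)
      thus "i = j"
        using less[OF ij] less[OF ij(2,1)] by (metis nat_neq_iff)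
    qed
    moreover have "(\<lambda>i. t i div n) ` A c \<subseteq> {..<s}"
    proof
      fix q
      assume "q \<in> (\<lambda>i. t i div n) ` A c"
      then obtain i where i: "i \<in> A c" "q = t i div n" by blast
      have "t i < C (Suc i)" "i < N"
        using t[OF i(1)] i(1) by (auto simp: A_def)
      hence "t i < n * s"
        using C_mono[of "Suc i" N] total by (simp add: C_def)
      thus "q \<in> {..<s}"
        using i(2) by (simp add: less_mult_imp_div_less mult.commute)
    qed
    ultimately show "card (A c) \<le> s"
      using card_inj_on_le[of _ "A c" "{..<s}"] by auto
  next
    fix i
    assume i: "i < N"
    have "{c. c < n \<and> i \<in> A c} = (\<lambda>t. t mod n) ` {C i..<C (Suc i)}"
      using i n by (auto simp: A_def)
    moreover have "inj_on (\<lambda>t. t mod n) {C i..<C (Suc i)}"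
    proof (rule linorder_inj_onI')
      fix t u
      assume tu: "t \<in> {C i..<C (Suc i)}" "u \<in> {C i..<C (Suc i)}" "t < u"
      hence "0 < u - t" "u - t < n"
        using le[OF i] by (auto simp: C_Suc)
      hence "\<not> n dvd u - t"
        by (meson nat_dvd_not_less)
      thus "t mod n \<noteq> u mod n"
        using tu(3) mod_eq_dvd_iff_nat[of t u n] by auto
    qed
    ultimately show "card {c. c < n \<and> i \<in> A c} = w i"
      by (simp add: card_image C_Suc)
  qed
qed

lemma norm_integer_sum_le:
  fixes \<phi> :: "nat \<Rightarrow> 'a::banach" and v :: "nat \<Rightarrow> real"
  assumes bound: "subsymmetric_bound \<phi> 1" and n: "0 < n"
    and v_int: "\<And>i. i < N \<Longrightarrow> v i \<in> \<int>"
    and v_le: "\<And>i. i < N \<Longrightarrow> \<bar>v i\<bar> \<le> real n"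
    and v_sum: "(\<Sum>i<N. \<bar>v i\<bar>) \<le> real n * real s"
  shows "norm (\<Sum>i<N. v i *\<^sub>R \<phi> i) \<le> fundamental_fun \<phi> s * real n"
proof -
  define w where "w i = nat \<lfloor>\<bar>v i\<bar>\<rfloor>" for i
  have w: "real (w i) = \<bar>v i\<bar>" if "i < N" for i
    using v_int[OF that] by (auto simp: w_def elim!: Ints_cases)
  have w_le: "w i \<le> n" if "i < N" for i
    using v_le[OF that] w[OF that] by simp
  have "real (\<Sum>i<N. w i) \<le> real (n * s)"
    using v_sum w by simp
  hence w_sum: "(\<Sum>i<N. w i) \<le> n * s"
    by (simp only: of_nat_le_iff)
  obtain A where A: "\<And>c. A c \<subseteq> {..<N}" "\<And>c. card (A c) \<le> s"
    "\<And>i. i < N \<Longrightarrow> card {c. c < n \<and> i \<in> A c} = w i"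
    using round_robin_decomposition[OF n w_le w_sum] by blast
  \<comment> \<open>\<open>sgn (v i)\<close> would vanish where \<open>v i = 0\<close>, but only \<open>\<plusminus>1\<close> may be used as a sign.\<close>
  define \<theta> :: "nat \<Rightarrow> real" where "\<theta> i = (if v i < 0 then -1 else 1)" for i
  have "(\<Sum>i<N. v i *\<^sub>R \<phi> i) = (\<Sum>i<N. (\<theta> i * \<bar>v i\<bar>) *\<^sub>R \<phi> (id i))"
    by (rule sum.cong) (auto simp: \<theta>_def)
  also have "norm \<dots> \<le> 1 * norm (\<Sum>i<N. \<bar>v i\<bar> *\<^sub>R \<phi> i)"
    by (rule norm_sum_spread_signs_le[OF bound]) (auto simp: \<theta>_def strict_mono_def)
  also have "(\<Sum>i<N. \<bar>v i\<bar> *\<^sub>R \<phi> i) = (\<Sum>i<N. \<Sum>c<n. if i \<in> A c then \<phi> i else 0)"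
  proof (rule sum.cong[OF refl])
    fix i
    assume i: "i \<in> {..<N}"
    have "(\<Sum>c<n. if i \<in> A c then \<phi> i else 0) = (\<Sum>c | c < n \<and> i \<in> A c. \<phi> i)"
      by (rule sum.mono_neutral_cong_right) auto
    also have "\<dots> = \<bar>v i\<bar> *\<^sub>R \<phi> i"
      using A(3)[of i] w[of i] i by (simp add: sum_constant_scaleR)
    finally show "\<bar>v i\<bar> *\<^sub>R \<phi> i = (\<Sum>c<n. if i \<in> A c then \<phi> i else 0)" ..
  qed
  also have "\<dots> = (\<Sum>c<n. \<Sum>i<N. if i \<in> A c then \<phi> i else 0)"
    by (rule sum.swap)
  also have "\<dots> = (\<Sum>c<n. \<Sum>i\<in>A c. \<phi> i)"
    using A(1) by (intro sum.cong refl sum.mono_neutral_cong_right) auto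
  also have "1 * norm \<dots> \<le> (\<Sum>c<n. norm (\<Sum>i\<in>A c. \<phi> i))"
    using norm_sum[of "\<lambda>c. \<Sum>i\<in>A c. \<phi> i" "{..<n}"] by simp
  also have "\<dots> \<le> (\<Sum>c<n. fundamental_fun \<phi> s)"
    using A(1,2) by (intro sum_mono norm_sum_le_fundamental_fun[OF bound])
      (auto intro: finite_subset)
  finally show ?thesis
    by (simp add: mult.commute)
qed

section \<open>Partial row sums of Hadamard matrices\<close>

text \<open>
  The hypothesis says \<open>H\<^sup>T H = n I\<close>; since a one-sided inverse of a square matrix is two-sided,
  also \<open>H H\<^sup>T = n I\<close>.
\<close>

lemma hadamard_rows_orthogonal:
  assumes H: "H \<in> hadamard_matrices n" and n: "0 < n" and kl: "k < n" "l < n"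
  shows "(\<Sum>i<n. H $$ (k, i) * H $$ (l, i)) = (if k = l then real n else 0)"
proof -
  have carrier: "H \<in> carrier_mat n n"
    and sgn: "\<And>k i. k < n \<Longrightarrow> i < n \<Longrightarrow> H $$ (k, i) \<in> {-1, 1}"
    and orth: "\<And>i j. i < n \<Longrightarrow> j < n \<Longrightarrow> i \<noteq> j \<Longrightarrow> col H i \<bullet> col H j = 0"
    using H by (auto simp: hadamard_matrices_def)
  have sq: "H $$ (k, i) * H $$ (k, i) = 1" if "k < n" "i < n" for k i
    using sgn[OF that] by auto
  define G where "G = (1 / real n) \<cdot>\<^sub>m transpose_mat H"
  have G: "G \<in> carrier_mat n n"
    using carrier by (simp add: G_def)
  have "G * H = 1\<^sub>m n"
  proof (rule eq_matI)
    fix i j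
    assume "i < dim_row (1\<^sub>m n :: real mat)" "j < dim_col (1\<^sub>m n :: real mat)"
    hence ij: "i < n" "j < n" by auto
    have "col H i \<bullet> col H j = (if i = j then real n else 0)"
    proof (cases "i = j")
      case True
      thus ?thesis
        using carrier ij sq by (simp add: scalar_prod_def)
    qed (simp add: orth ij)
    thus "(G * H) $$ (i, j) = 1\<^sub>m n $$ (i, j)"
      using carrier ij n by (simp add: G_def)
  qed (use carrier G in auto)
  hence "H * G = 1\<^sub>m n"
    by (rule mat_mult_left_right_inverse[OF G carrier])
  hence "(H * G) $$ (k, l) = (if k = l then 1 else 0)"
    using kl by simp
  moreover have "(H * G) $$ (k, l) = (\<Sum>i<n. H $$ (k, i) * H $$ (l, i)) / real n"
    using carrier kl by (simp add: G_def scalar_prod_def sum_divide_distrib atLeast0LessThan)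
  ultimately show ?thesis
    using n by (simp add: field_simps split: if_splits)
qed

lemma hadamard_row_sum_square_norm:
  assumes H: "H \<in> hadamard_matrices n" and n: "0 < n" and m: "m \<le> n"
  shows "(\<Sum>i<n. (\<Sum>k<m. H $$ (k, i))\<^sup>2) = real m * real n"
proof -
  have "(\<Sum>i<n. (\<Sum>k<m. H $$ (k, i))\<^sup>2) = (\<Sum>i<n. \<Sum>k<m. \<Sum>l<m. H $$ (k, i) * H $$ (l, i))"
    by (simp add: power2_eq_square sum_product)
  also have "\<dots> = (\<Sum>k<m. \<Sum>i<n. \<Sum>l<m. H $$ (k, i) * H $$ (l, i))"
    by (rule sum.swap)
  also have "\<dots> = (\<Sum>k<m. \<Sum>l<m. \<Sum>i<n. H $$ (k, i) * H $$ (l, i))"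
    by (intro sum.cong refl sum.swap)
  also have "\<dots> = (\<Sum>k<m. \<Sum>l<m. if k = l then real n else 0)"
    using m by (intro sum.cong refl hadamard_rows_orthogonal[OF H n]) auto
  also have "\<dots> = real m * real n"
    by simp
  finally show ?thesis .
qed

lemma hadamard_row_sum_abs_le:
  assumes H: "H \<in> hadamard_matrices n" and n: "0 < n" and m: "m \<le> n"
  shows "(\<Sum>i<n. \<bar>\<Sum>k<m. H $$ (k, i)\<bar>) \<le> real n * sqrt (real n)"
proof -
  define v where "v i = (\<Sum>k<m. H $$ (k, i))" for i
  define r where "r = sqrt (real n)"
  have r: "0 < r" "r * r = real n"
    using n by (simp_all add: r_def)
  have "(\<Sum>i<n. 2 * r * \<bar>v i\<bar>) \<le> (\<Sum>i<n. (v i)\<^sup>2 + r\<^sup>2)"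
    using sum_squares_bound[of "\<bar>v i\<bar>" r for i] by (intro sum_mono) (simp add: mult_ac)
  also have "\<dots> = real m * real n + real n * real n"
    using hadamard_row_sum_square_norm[OF assms] r
    by (simp add: v_def sum.distrib power2_eq_square)
  also have "\<dots> \<le> real n * real n + real n * real n"
    using m by (intro add_right_mono mult_right_mono) auto
  also have "\<dots> = 2 * r * (real n * r)"
    using r by (simp add: mult_ac)
  finally have "2 * r * (\<Sum>i<n. \<bar>v i\<bar>) \<le> 2 * r * (real n * r)"
    by (simp add: sum_distrib_left)
  thus ?thesis
    using r(1) by (simp add: v_def r_def)
qed

lemma norm_hadamard_row_sum_le:
  fixes \<phi> :: "nat \<Rightarrow> 'a::banach"
  assumes bound: "subsymmetric_bound \<phi> 1"
    and H: "H \<in> hadamard_matrices n" and n: "0 < n" and m: "m \<le> n"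
    and s: "sqrt (real n) \<le> real s"
  shows "norm (\<Sum>i<n. (\<Sum>k<m. H $$ (k, i)) *\<^sub>R \<phi> i) \<le> fundamental_fun \<phi> s * real n"
proof (rule norm_integer_sum_le[OF bound n])
  have entry: "H $$ (k, i) \<in> {-1, 1}" if "k < m" "i < n" for k i
    using H m that by (auto simp: hadamard_matrices_def)
  show "(\<Sum>k<m. H $$ (k, i)) \<in> \<int>" if "i < n" for i
    using entry that by (intro Ints_sum) fastforce
  show "\<bar>\<Sum>k<m. H $$ (k, i)\<bar> \<le> real n" if "i < n" for i
  proof -
    have "\<bar>\<Sum>k<m. H $$ (k, i)\<bar> \<le> (\<Sum>k<m. \<bar>H $$ (k, i)\<bar>)"
      by (rule sum_abs)
    also have "\<dots> \<le> (\<Sum>k<m. 1)"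
      using entry that by (intro sum_mono) fastforce
    finally show ?thesis
      using m by simp
  qed
  have "(\<Sum>i<n. \<bar>\<Sum>k<m. H $$ (k, i)\<bar>) \<le> real n * sqrt (real n)"
    by (rule hadamard_row_sum_abs_le[OF H n m])
  also have "\<dots> \<le> real n * real s"
    using s by (intro mult_left_mono) auto
  finally show "(\<Sum>i<n. \<bar>\<Sum>k<m. H $$ (k, i)\<bar>) \<le> real n * real s" .
qed

theorem theorem4p8:
  fixes \<phi> :: "nat \<Rightarrow> 'a::banach"
  assumes "normalized \<phi>"
    and "subsymmetric_basis \<phi>"
    and "is_subsymmetric_constant \<phi> 1"
  shows "\<forall>n\<in>hadamard_orders.
    rho \<phi> n \<le> fundamental_fun \<phi> (nat \<lfloor>sqrt (real n)\<rfloor> + 1) * real n"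
proof
  fix n
  assume "n \<in> hadamard_orders"
  hence n: "0 < n" and ne: "hadamard_matrices n \<noteq> {}"
    by (auto simp: hadamard_orders_def)
  define s where "s = nat \<lfloor>sqrt (real n)\<rfloor> + 1"
  have s: "sqrt (real n) \<le> real s"
    unfolding s_def by linarith
  have bound: "subsymmetric_bound \<phi> 1"
    using assms(3) by (simp add: is_subsymmetric_constant_def)
  have "rho_mat \<phi> n H \<le> fundamental_fun \<phi> s * real n" if "H \<in> hadamard_matrices n" for H
    unfolding rho_mat_def
    using n norm_hadamard_row_sum_le[OF bound that n _ s] by (subst Max_le_iff) auto
  thus "rho \<phi> n \<le> fundamental_fun \<phi> (nat \<lfloor>sqrt (real n)\<rfloor> + 1) * real n"
    unfolding rho_def s_def[symmetric]
    using ne finite_hadamard_matrices by (subst Max_le_iff) auto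
qed

end
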